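(* Every weakly right noetherian regular monoid is right coherent.
   Context: A monoid $S$ is regular if for every $a\in S$ there is $b\in S$ with $a=aba$. A right ideal of $S$ is a subset $I$ with $IS\subseteq I$ (the empty set is allowed, and is finitely generated); it is finitely generated if it is a finite union of sets $aS$ with $a\in I$. $S$ is weakly right noetherian if every right ideal of $S$ is finitely generated. A right $S$-act is a set $A$ with a map $A\times S\to A$, $(a,s)\mapsto as$, with $a1=a$ and $a(st)=(as)t$. The free right $S$-act on a set $X$ is $F_S(X)=X\times S$ with $(x,s)t=(x,st)$. A congruence on a right $S$-act is an equivalence relation preserved by the action; it is finitely generated if it is the smallest congruence containing some finite set of pairs. An act $A$ is finitely generated if $A=a_1S\cup\dots\cup a_nS$ for some $a_i\in A$, and finitely presented if it is isomorphic to $F_S(X)/\rho$ with $X$ finite and $\rho$ a finitely generated congruence. The empty set is allowed as a subact (and is finitely generated). The monoid $S$ is right coherent if every finitely generated subact of every finitely presented right $S$-act is finitely presented. *)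

theory Defs
  imports "HOL-Algebra.Group"
begin

definition regular_monoid :: "('a, 'm) monoid_scheme \<Rightarrow> bool" where
  "regular_monoid S \<longleftrightarrow>
     monoid S \<and> (\<forall>a\<in>carrier S. \<exists>b\<in>carrier S. a = a \<otimes>\<^bsub>S\<^esub> b \<otimes>\<^bsub>S\<^esub> a)"

text \<open>The empty set is a right ideal, and it is finitely generated (take \<open>F = {}\<close> below).\<close>

definition right_ideal :: "('a, 'm) monoid_scheme \<Rightarrow> 'a set \<Rightarrow> bool" where
  "right_ideal S I \<longleftrightarrow>
     I \<subseteq> carrier S \<and> (\<forall>a\<in>I. \<forall>s\<in>carrier S. a \<otimes>\<^bsub>S\<^esub> s \<in> I)"

definition fg_right_ideal :: "('a, 'm) monoid_scheme \<Rightarrow> 'a set \<Rightarrow> bool" where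
  "fg_right_ideal S I \<longleftrightarrow>
     right_ideal S I \<and>
     (\<exists>F. finite F \<and> F \<subseteq> I \<and> I = (\<Union>a\<in>F. (\<lambda>s. a \<otimes>\<^bsub>S\<^esub> s) ` carrier S))"

definition weakly_right_noetherian :: "('a, 'm) monoid_scheme \<Rightarrow> bool" where
  "weakly_right_noetherian S \<longleftrightarrow> (\<forall>I. right_ideal S I \<longrightarrow> fg_right_ideal S I)"

text \<open>A right act is given by a carrier set \<open>A\<close>, which may be empty, and an action \<open>act\<close>,
  whose values matter only on \<open>A\<close> and \<open>carrier S\<close>.\<close>

locale right_act = monoid S
  for S :: "('a, 'm) monoid_scheme" (structure) +
  fixes A :: "'b set" and act :: "'b \<Rightarrow> 'a \<Rightarrow> 'b"
  assumes act_closed: "\<lbrakk>a \<in> A; s \<in> carrier S\<rbrakk> \<Longrightarrow> act a s \<in> A"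
    and act_one: "a \<in> A \<Longrightarrow> act a \<one> = a"
    and act_mult: "\<lbrakk>a \<in> A; s \<in> carrier S; t \<in> carrier S\<rbrakk>
      \<Longrightarrow> act a (s \<otimes> t) = act (act a s) t"

definition subact ::
  "('a, 'm) monoid_scheme \<Rightarrow> 'b set \<Rightarrow> ('b \<Rightarrow> 'a \<Rightarrow> 'b) \<Rightarrow> 'b set \<Rightarrow> bool" where
  "subact S A act B \<longleftrightarrow> B \<subseteq> A \<and> (\<forall>b\<in>B. \<forall>s\<in>carrier S. act b s \<in> B)"

definition fg_act :: "('a, 'm) monoid_scheme \<Rightarrow> 'b set \<Rightarrow> ('b \<Rightarrow> 'a \<Rightarrow> 'b) \<Rightarrow> bool" where
  "fg_act S A act \<longleftrightarrow>
     (\<exists>F. finite F \<and> F \<subseteq> A \<and> A = (\<Union>a\<in>F. act a ` carrier S))"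

definition act_congruence ::
  "('a, 'm) monoid_scheme \<Rightarrow> 'b set \<Rightarrow> ('b \<Rightarrow> 'a \<Rightarrow> 'b) \<Rightarrow> ('b \<times> 'b) set \<Rightarrow> bool" where
  "act_congruence S A act \<rho> \<longleftrightarrow>
     equiv A \<rho> \<and> (\<forall>(a, b)\<in>\<rho>. \<forall>s\<in>carrier S. (act a s, act b s) \<in> \<rho>)"

definition fg_congruence ::
  "('a, 'm) monoid_scheme \<Rightarrow> 'b set \<Rightarrow> ('b \<Rightarrow> 'a \<Rightarrow> 'b) \<Rightarrow> ('b \<times> 'b) set \<Rightarrow> bool" where
  "fg_congruence S A act \<rho> \<longleftrightarrow>
     act_congruence S A act \<rho> \<and>
     (\<exists>R. finite R \<and> R \<subseteq> \<rho> \<and>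
        (\<forall>\<sigma>. act_congruence S A act \<sigma> \<and> R \<subseteq> \<sigma> \<longrightarrow> \<rho> \<subseteq> \<sigma>))"

definition free_act_carrier :: "('a, 'm) monoid_scheme \<Rightarrow> 'x set \<Rightarrow> ('x \<times> 'a) set" where
  "free_act_carrier S X = X \<times> carrier S"

definition free_act :: "('a, 'm) monoid_scheme \<Rightarrow> 'x \<times> 'a \<Rightarrow> 'a \<Rightarrow> 'x \<times> 'a" where
  "free_act S p t = (fst p, snd p \<otimes>\<^bsub>S\<^esub> t)"

text \<open>The action on the quotient set \<open>A // \<rho>\<close>: a class \<open>C\<close> is sent by \<open>s\<close> to the class
  containing the translates of the elements of \<open>C\<close>; see \<open>quotient_act_class\<close>.\<close>

definition quotient_act ::
  "('b \<Rightarrow> 'a \<Rightarrow> 'b) \<Rightarrow> ('b \<times> 'b) set \<Rightarrow> 'b set \<Rightarrow> 'a \<Rightarrow> 'b set" where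
  "quotient_act act \<rho> C s = \<rho> `` ((\<lambda>c. act c s) ` C)"

definition act_isomorphic ::
  "('a, 'm) monoid_scheme \<Rightarrow> 'b set \<Rightarrow> ('b \<Rightarrow> 'a \<Rightarrow> 'b)
     \<Rightarrow> 'c set \<Rightarrow> ('c \<Rightarrow> 'a \<Rightarrow> 'c) \<Rightarrow> bool" where
  "act_isomorphic S A act B act' \<longleftrightarrow>
     (\<exists>f. bij_betw f A B \<and> (\<forall>a\<in>A. \<forall>s\<in>carrier S. f (act a s) = act' (f a) s))"

text \<open>Up to isomorphism the free act on \<open>X\<close> depends only on the cardinality of \<open>X\<close>, so the finite
  set \<open>X\<close> may be taken among the sets of natural numbers.\<close>

definition fp_act :: "('a, 'm) monoid_scheme \<Rightarrow> 'b set \<Rightarrow> ('b \<Rightarrow> 'a \<Rightarrow> 'b) \<Rightarrow> bool" where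
  "fp_act S A act \<longleftrightarrow>
     (\<exists>(X :: nat set) \<rho>. finite X \<and>
        fg_congruence S (free_act_carrier S X) (free_act S) \<rho> \<and>
        act_isomorphic S A act
          (free_act_carrier S X // \<rho>) (quotient_act (free_act S) \<rho>))"

text \<open>HOL cannot quantify over types inside a definition, so the type \<open>'b\<close> in which the acts live
  is a parameter; coherence of \<open>S\<close> is \<open>right_coherent TYPE('b) S\<close> for every type \<open>'b\<close>.\<close>

definition right_coherent :: "'b itself \<Rightarrow> ('a, 'm) monoid_scheme \<Rightarrow> bool" where
  "right_coherent _ S \<longleftrightarrow>
     (\<forall>(A :: 'b set) act B.
        right_act S A act \<and> fp_act S A act \<and> subact S A act B \<and> fg_act S B act
        \<longrightarrow> fp_act S B act)"

lemma quotient_act_class: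
  assumes "act_congruence S A act \<rho>" "a \<in> A" "s \<in> carrier S"
  shows "quotient_act act \<rho> (\<rho> `` {a}) s = \<rho> `` {act a s}"
proof -
  have e: "equiv A \<rho>" and c: "\<And>b. (a, b) \<in> \<rho> \<Longrightarrow> (act a s, act b s) \<in> \<rho>"
    using assms by (auto simp: act_congruence_def)
  have "\<rho> `` {act b s} = \<rho> `` {act a s}" if "(a, b) \<in> \<rho>" for b
    using equiv_class_eq[OF e c[OF that]] by simp
  moreover have "(a, a) \<in> \<rho>"
    using e assms(2) by (meson equiv_class_self Image_singleton_iff)
  ultimately show ?thesis
    unfolding quotient_act_def by blast
qed

lemma right_act_free_act:
  assumes "monoid S"
  shows "right_act S (free_act_carrier S X) (free_act S)"
proof -
  interpret monoid S by fact
  show ?thesis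
    by unfold_locales (auto simp: free_act_carrier_def free_act_def m_assoc)
qed

lemma right_act_quotient_act:
  assumes "right_act S A act" "act_congruence S A act \<rho>"
  shows "right_act S (A // \<rho>) (quotient_act act \<rho>)"
proof -
  interpret right_act S A act by fact
  show ?thesis
    by unfold_locales
      (auto elim!: quotientE simp: quotient_act_class[OF assms(2)] act_closed act_one act_mult
        intro!: quotientI)
qed

end

theory Submission
  imports Defs
begin

text \<open>
  Let \<open>\<rho>\<close> be the kernel of a surjection \<open>F(X) \<rightarrow> A\<close>, generated by a finite set \<open>R\<close>. The preimage in
  \<open>F(X)\<close> of a subact \<open>B\<close> of \<open>A\<close> is a finite union of sets \<open>{x} \<times> eS\<close>; by regularity each \<open>e\<close> may be
  taken idempotent. Taking one generator \<open>y\<close> for each pair \<open>(x\<^sub>y, e\<^sub>y)\<close> that occurs, \<open>B\<close> is presented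
  by the relations \<open>y e\<^sub>y = y\<close>; \<open>y w = z w\<close> when \<open>x\<^sub>y = x\<^sub>z\<close>, where \<open>w\<close> runs through generators of
  \<open>e\<^sub>yS \<inter> e\<^sub>zS\<close>; and \<open>y p v = z q v\<close> for \<open>((x\<^sub>y, p), (x\<^sub>z, q)) \<in> R\<close>, where \<open>v\<close> runs through generators
  of the right ideal of all \<open>v\<close> with \<open>p v \<in> e\<^sub>yS\<close> and \<open>q v \<in> e\<^sub>zS\<close>. Since \<open>e\<^sub>y\<close> is idempotent,
  \<open>e\<^sub>y s\<close> determines \<open>y s\<close> modulo the first relations, and a chain of \<open>R\<close>-steps that starts in the
  preimage of \<open>B\<close> never leaves it.
\<close>

section \<open>Maps out of free acts, and congruences\<close>

definition free_act_map :: "('x \<Rightarrow> 'b) \<Rightarrow> ('b \<Rightarrow> 'a \<Rightarrow> 'b) \<Rightarrow> 'x \<times> 'a \<Rightarrow> 'b" where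
  "free_act_map g act p = act (g (fst p)) (snd p)"

text \<open>When \<open>g\<close> maps \<open>X\<close> into an act,
  \<open>free_act_map g act\<close> is the homomorphism given by the universal property of the free
  act. The carrier conditions make its kernel a relation on that free act.\<close>

definition free_act_kernel ::
  "('a, 'm) monoid_scheme \<Rightarrow> 'x set \<Rightarrow> ('x \<Rightarrow> 'b) \<Rightarrow> ('b \<Rightarrow> 'a \<Rightarrow> 'b)
    \<Rightarrow> (('x \<times> 'a) \<times> ('x \<times> 'a)) set" where
  "free_act_kernel S X g act = {(p, q). p \<in> free_act_carrier S X \<and> q \<in> free_act_carrier S X \<and>
     free_act_map g act p = free_act_map g act q}"

lemma act_congruenceD:
  assumes "act_congruence S A act \<rho>"
  shows "\<And>a. a \<in> A \<Longrightarrow> (a, a) \<in> \<rho>"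
    and "\<And>a b. (a, b) \<in> \<rho> \<Longrightarrow> (b, a) \<in> \<rho>"
    and "\<And>a b c. (a, b) \<in> \<rho> \<Longrightarrow> (b, c) \<in> \<rho> \<Longrightarrow> (a, c) \<in> \<rho>"
    and "\<And>a b s. (a, b) \<in> \<rho> \<Longrightarrow> s \<in> carrier S \<Longrightarrow> (act a s, act b s) \<in> \<rho>"
    and "\<And>a b. (a, b) \<in> \<rho> \<Longrightarrow> a \<in> A \<and> b \<in> A"
proof -
  have \<rho>: "refl_on A \<rho>" "sym \<rho>" "trans \<rho>" "\<rho> \<subseteq> A \<times> A"
    and act: "\<forall>(a, b)\<in>\<rho>. \<forall>s\<in>carrier S. (act a s, act b s) \<in> \<rho>"
    using assms by (auto simp: act_congruence_def equiv_def)
  show "\<And>a. a \<in> A \<Longrightarrow> (a, a) \<in> \<rho>"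
    using \<rho>(1) by (rule refl_onD)
  show "\<And>a b. (a, b) \<in> \<rho> \<Longrightarrow> (b, a) \<in> \<rho>"
    using \<rho>(2) by (rule symD)
  show "\<And>a b c. (a, b) \<in> \<rho> \<Longrightarrow> (b, c) \<in> \<rho> \<Longrightarrow> (a, c) \<in> \<rho>"
    using \<rho>(3) by (rule transD)
  show "\<And>a b s. (a, b) \<in> \<rho> \<Longrightarrow> s \<in> carrier S \<Longrightarrow> (act a s, act b s) \<in> \<rho>"
    using act by blast
  show "\<And>a b. (a, b) \<in> \<rho> \<Longrightarrow> a \<in> A \<and> b \<in> A"
    using \<rho>(4) by blast
qed

lemma act_congruenceI:
  assumes "\<rho> \<subseteq> A \<times> A"
    and "\<And>a. a \<in> A \<Longrightarrow> (a, a) \<in> \<rho>"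
    and "\<And>a b. (a, b) \<in> \<rho> \<Longrightarrow> (b, a) \<in> \<rho>"
    and "\<And>a b c. (a, b) \<in> \<rho> \<Longrightarrow> (b, c) \<in> \<rho> \<Longrightarrow> (a, c) \<in> \<rho>"
    and "\<And>a b s. (a, b) \<in> \<rho> \<Longrightarrow> s \<in> carrier S \<Longrightarrow> (act a s, act b s) \<in> \<rho>"
  shows "act_congruence S A act \<rho>"
proof -
  have "refl_on A \<rho>" "sym \<rho>" "trans \<rho>"
    by (rule refl_onI[OF assms(2)] symI[OF assms(3)] transI[OF assms(4)], assumption+)+
  then show ?thesis
    using assms(1,5) by (auto simp: act_congruence_def equiv_def)
qed

section \<open>Generators of right ideals\<close>

lemma weakly_right_noetherianE:
  assumes "weakly_right_noetherian S" "right_ideal S I"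
  obtains F where "finite F" "F \<subseteq> I" "\<And>u. u \<in> I \<Longrightarrow> \<exists>a\<in>F. \<exists>s\<in>carrier S. u = a \<otimes>\<^bsub>S\<^esub> s"
proof -
  obtain F where "finite F" "F \<subseteq> I" and I: "I = (\<Union>a\<in>F. (\<lambda>s. a \<otimes>\<^bsub>S\<^esub> s) ` carrier S)"
    using assms unfolding weakly_right_noetherian_def fg_right_ideal_def by metis
  moreover have "\<exists>a\<in>F. \<exists>s\<in>carrier S. u = a \<otimes>\<^bsub>S\<^esub> s" if "u \<in> I" for u
    using that I by auto
  ultimately show thesis
    using that by blast
qed

text \<open>If \<open>a = a b a\<close>, then \<open>a b\<close> is an idempotent of
  \<open>I\<close>, and \<open>(a b) a = a\<close> shows that it generates the same right ideal as
  \<open>a\<close>. So finitely many generators can be replaced by idempotents, and membership of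
  \<open>u\<close> in \<open>e S\<close> takes the form \<open>u = e u\<close>.\<close>

lemma idempotent_generators:
  assumes "weakly_right_noetherian S" "regular_monoid S" "right_ideal S I"
  obtains E where "finite E" "E \<subseteq> I" "\<And>e. e \<in> E \<Longrightarrow> e \<otimes>\<^bsub>S\<^esub> e = e"
    "\<And>u. u \<in> I \<Longrightarrow> \<exists>e\<in>E. u = e \<otimes>\<^bsub>S\<^esub> u"
proof -
  interpret monoid S
    using assms(2) by (simp add: regular_monoid_def)
  obtain F where F: "finite F" "F \<subseteq> I"
    and gen: "\<And>u. u \<in> I \<Longrightarrow> \<exists>a\<in>F. \<exists>s\<in>carrier S. u = a \<otimes>\<^bsub>S\<^esub> s"
    using weakly_right_noetherianE[OF assms(1,3)] by blast
  have I: "I \<subseteq> carrier S" "\<And>a s. a \<in> I \<Longrightarrow> s \<in> carrier S \<Longrightarrow> a \<otimes>\<^bsub>S\<^esub> s \<in> I"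
    using assms(3) by (auto simp: right_ideal_def)
  obtain b where b: "\<And>a. a \<in> carrier S \<Longrightarrow> b a \<in> carrier S"
    "\<And>a. a \<in> carrier S \<Longrightarrow> a \<otimes>\<^bsub>S\<^esub> b a \<otimes>\<^bsub>S\<^esub> a = a"
    using assms(2) unfolding regular_monoid_def by metis
  show thesis
  proof
    show "finite ((\<lambda>a. a \<otimes>\<^bsub>S\<^esub> b a) ` F)"
      using F by simp
    show "(\<lambda>a. a \<otimes>\<^bsub>S\<^esub> b a) ` F \<subseteq> I"
      using F I b by blast
    show "e \<otimes>\<^bsub>S\<^esub> e = e" if e: "e \<in> (\<lambda>a. a \<otimes>\<^bsub>S\<^esub> b a) ` F" for e
    proof -
      obtain a where a: "a \<in> carrier S" "e = a \<otimes>\<^bsub>S\<^esub> b a"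
        using e F(2) I(1) by auto
      have "e \<otimes>\<^bsub>S\<^esub> e = (a \<otimes>\<^bsub>S\<^esub> b a \<otimes>\<^bsub>S\<^esub> a) \<otimes>\<^bsub>S\<^esub> b a"
        using a b(1) by (simp add: m_assoc)
      then show ?thesis
        using a b(2) by simp
    qed
    show "\<exists>e\<in>(\<lambda>a. a \<otimes>\<^bsub>S\<^esub> b a) ` F. u = e \<otimes>\<^bsub>S\<^esub> u" if u: "u \<in> I" for u
    proof -
      obtain a s where a: "a \<in> F" "a \<in> carrier S" "s \<in> carrier S" "u = a \<otimes>\<^bsub>S\<^esub> s"
        using gen[OF u] F(2) I(1) by blast
      have "(a \<otimes>\<^bsub>S\<^esub> b a) \<otimes>\<^bsub>S\<^esub> u = (a \<otimes>\<^bsub>S\<^esub> b a \<otimes>\<^bsub>S\<^esub> a) \<otimes>\<^bsub>S\<^esub> s"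
        using a b(1) by (simp add: m_assoc)
      then show ?thesis
        using a b(2) by (metis imageI)
    qed
  qed
qed

lemma right_ideal_inter:
  "right_ideal S I \<Longrightarrow> right_ideal S J \<Longrightarrow> right_ideal S (I \<inter> J)"
  unfolding right_ideal_def by blast

lemma (in monoid) right_ideal_colon:
  assumes "right_ideal G I" "p \<in> carrier G"
  shows "right_ideal G {v \<in> carrier G. p \<otimes> v \<in> I}"
  using assms by (auto simp: right_ideal_def m_assoc[symmetric])

lemma (in monoid) right_ideal_principal:
  assumes "e \<in> carrier G"
  shows "right_ideal G ((\<lambda>s. e \<otimes> s) ` carrier G)"
  using assms by (auto simp: right_ideal_def m_assoc)

section \<open>Finite presentations by generators and kernels\<close>

context right_act
begin

lemma free_act_map_free_act:
  assumes "g ` X \<subseteq> A" "p \<in> free_act_carrier S X" "s \<in> carrier S"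
  shows "free_act_map g act (free_act S p s) = act (free_act_map g act p) s"
  using assms by (auto simp: free_act_map_def free_act_def free_act_carrier_def act_mult)

lemma free_act_closed:
  assumes "p \<in> free_act_carrier S X" "s \<in> carrier S"
  shows "free_act S p s \<in> free_act_carrier S X"
  using assms by (auto simp: free_act_def free_act_carrier_def)

lemma act_congruence_free_act_kernel:
  assumes "g ` X \<subseteq> A"
  shows "act_congruence S (free_act_carrier S X) (free_act S) (free_act_kernel S X g act)"
  using assms
  by (intro act_congruenceI)
    (auto simp: free_act_kernel_def free_act_closed free_act_map_free_act)

text \<open>The first isomorphism theorem replaces the isomorphism with a quotient by a choice of
  generators \<open>g\<close> in the act itself. A subact can then be presented by naming elements
  of it and studying one kernel.\<close>

lemma fp_act_iff:
  "fp_act S A act \<longleftrightarrow>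
    (\<exists>(X :: nat set) g. finite X \<and> g ` X \<subseteq> A \<and>
       free_act_map g act ` free_act_carrier S X = A \<and>
       fg_congruence S (free_act_carrier S X) (free_act S) (free_act_kernel S X g act))"
  (is "?L \<longleftrightarrow> ?R")
proof
  assume ?L
  then obtain X :: "nat set" and \<rho> f where X: "finite X"
    and fg: "fg_congruence S (free_act_carrier S X) (free_act S) \<rho>"
    and bij: "bij_betw f A (free_act_carrier S X // \<rho>)"
    and hom: "\<And>a s. a \<in> A \<Longrightarrow> s \<in> carrier S \<Longrightarrow> f (act a s) = quotient_act (free_act S) \<rho> (f a) s"
    unfolding fp_act_def act_isomorphic_def by blast
  \<comment> \<open>The generator \<open>g x\<close> corresponds under \<open>f\<close> to the class
    of the basis element \<open>(x, \<one>)\<close>, so that \<open>f\<close> after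
    \<open>free_act_map g act\<close> is the quotient map.\<close>
  define g where "g = (\<lambda>x. the_inv_into A f (\<rho> `` {(x, \<one>)}))"
  have cong: "act_congruence S (free_act_carrier S X) (free_act S) \<rho>"
    using fg by (simp add: fg_congruence_def)
  then have eq: "equiv (free_act_carrier S X) \<rho>"
    by (simp add: act_congruence_def)
  have one: "(x, \<one>) \<in> free_act_carrier S X" if "x \<in> X" for x
    using that by (simp add: free_act_carrier_def)
  have fg1: "g x \<in> A" "f (g x) = \<rho> `` {(x, \<one>)}" if "x \<in> X" for x
  proof -
    have "\<rho> `` {(x, \<one>)} \<in> f ` A"
      using bij one[OF that] by (simp add: bij_betw_def quotientI)
    then show "g x \<in> A" "f (g x) = \<rho> `` {(x, \<one>)}"
      using bij unfolding g_def bij_betw_def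
      by (meson the_inv_into_into order_refl, meson f_the_inv_into_f)
  qed
  then have gX: "g ` X \<subseteq> A"
    by auto
  have val: "free_act_map g act p \<in> A" "f (free_act_map g act p) = \<rho> `` {p}"
    if "p \<in> free_act_carrier S X" for p
  proof -
    obtain x s where p: "p = (x, s)" "x \<in> X" "s \<in> carrier S"
      using \<open>p \<in> _\<close> by (auto simp: free_act_carrier_def)
    then show "free_act_map g act p \<in> A"
      using fg1(1) by (simp add: free_act_map_def act_closed)
    have "f (act (g x) s) = \<rho> `` {free_act S (x, \<one>) s}"
      using hom fg1 p quotient_act_class[OF cong one] by simp
    then show "f (free_act_map g act p) = \<rho> `` {p}"
      using p by (simp add: free_act_map_def free_act_def)
  qed
  have surj: "free_act_map g act ` free_act_carrier S X = A"
  proof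
    show "A \<subseteq> free_act_map g act ` free_act_carrier S X"
    proof
      fix a assume a: "a \<in> A"
      then have "f a \<in> free_act_carrier S X // \<rho>"
        using bij by (auto simp: bij_betw_def)
      then obtain p where p: "p \<in> free_act_carrier S X" "f a = \<rho> `` {p}"
        by (auto elim: quotientE)
      then have "a = free_act_map g act p"
        using val bij a by (metis bij_betw_def inj_onD)
      with p show "a \<in> free_act_map g act ` free_act_carrier S X"
        by blast
    qed
  qed (use val in auto)
  \<comment> \<open>As \<open>f\<close> is injective, equal values mean equal classes; so the kernel
    is \<open>\<rho>\<close> itself.\<close>
  have "free_act_map g act p = free_act_map g act q \<longleftrightarrow> (p, q) \<in> \<rho>"
    if "p \<in> free_act_carrier S X" "q \<in> free_act_carrier S X" for p q
    using val[OF that(1)] val[OF that(2)] bij eq_equiv_class_iff[OF eq that]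
    by (metis bij_betw_def inj_onD)
  then have "free_act_kernel S X g act = \<rho>"
    using act_congruenceD(5)[OF cong] by (auto simp: free_act_kernel_def)
  then show ?R
    using X gX surj fg by blast
next
  assume ?R
  then obtain X :: "nat set" and g where X: "finite X" and gX: "g ` X \<subseteq> A"
    and surj: "free_act_map g act ` free_act_carrier S X = A"
    and fg: "fg_congruence S (free_act_carrier S X) (free_act S) (free_act_kernel S X g act)"
    by blast
  let ?F = "free_act_carrier S X" and ?\<rho> = "free_act_kernel S X g act"
  \<comment> \<open>The classes of the kernel are the fibres of the map. Surjectivity makes the
    fibres over \<open>A\<close> nonempty, whence \<open>f\<close> is injective on
    \<open>A\<close>.\<close>
  define f where "f = (\<lambda>a. {p \<in> ?F. free_act_map g act p = a})"
  have cong: "act_congruence S ?F (free_act S) ?\<rho>"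
    using fg by (simp add: fg_congruence_def)
  have cls: "?\<rho> `` {p} = f (free_act_map g act p)" if "p \<in> ?F" for p
    using that by (auto simp: f_def free_act_kernel_def)
  have "inj_on f A"
  proof
    fix a b assume "a \<in> A" "b \<in> A" "f a = f b"
    then show "a = b"
      unfolding surj[symmetric] f_def by blast
  qed
  moreover have "f ` A = ?F // ?\<rho>"
    unfolding quotient_def using cls surj[symmetric] by auto
  moreover have "f (act a s) = quotient_act (free_act S) ?\<rho> (f a) s"
    if "a \<in> A" and s: "s \<in> carrier S" for a s
  proof -
    obtain p where p: "p \<in> ?F" "a = free_act_map g act p"
      using \<open>a \<in> A\<close> surj by blast
    then show ?thesis
      using quotient_act_class[OF cong p(1) s] cls[OF p(1)] cls[OF free_act_closed[OF p(1) s]]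
        free_act_map_free_act[OF gX p(1) s] by simp
  qed
  ultimately have "act_isomorphic S A act (?F // ?\<rho>) (quotient_act (free_act S) ?\<rho>)"
    unfolding act_isomorphic_def bij_betw_def by blast
  then show ?L
    unfolding fp_act_def using X fg by blast
qed

section \<open>Finite presentation of a subact\<close>

lemma fp_act_subact:
  assumes noeth: "weakly_right_noetherian S" and reg: "regular_monoid S"
    and fp: "fp_act S A act" and sub: "subact S A act B"
  shows "fp_act S B act"
proof -
  have BA: "B \<subseteq> A" and B_closed: "\<And>b s. b \<in> B \<Longrightarrow> s \<in> carrier S \<Longrightarrow> act b s \<in> B"
    using sub by (auto simp: subact_def)
  interpret B: right_act S B act
    using BA B_closed act_one act_mult by unfold_locales auto
  obtain X :: "nat set" and g where X: "finite X" and gX: "g ` X \<subseteq> A"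
    and surj: "free_act_map g act ` free_act_carrier S X = A"
    and fg: "fg_congruence S (free_act_carrier S X) (free_act S) (free_act_kernel S X g act)"
    using fp unfolding fp_act_iff by blast
  let ?F = "free_act_carrier S X" and ?\<rho> = "free_act_kernel S X g act"
  obtain R where R: "finite R" "R \<subseteq> ?\<rho>"
    and min: "\<And>\<sigma>. act_congruence S ?F (free_act S) \<sigma> \<Longrightarrow> R \<subseteq> \<sigma> \<Longrightarrow> ?\<rho> \<subseteq> \<sigma>"
    using fg unfolding fg_congruence_def by metis

  \<comment> \<open>This ideal holds the second coordinates of the preimage of \<open>B\<close> over
    \<open>x\<close>.\<close>
  have "right_ideal S {s \<in> carrier S. act (g x) s \<in> B}" if "x \<in> X" for x
    using that gX B_closed by (auto simp: right_ideal_def act_mult image_subset_iff)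
  then have "\<forall>x\<in>X. \<exists>E. finite E \<and> E \<subseteq> {s \<in> carrier S. act (g x) s \<in> B} \<and> (\<forall>e\<in>E. e \<otimes> e = e) \<and>
      (\<forall>u. u \<in> carrier S \<and> act (g x) u \<in> B \<longrightarrow> (\<exists>e\<in>E. u = e \<otimes> u))"
    using idempotent_generators[OF noeth reg] by (smt (verit) mem_Collect_eq)
  from bchoice[OF this] obtain E where E0: "\<forall>x\<in>X. finite (E x) \<and>
      E x \<subseteq> {s \<in> carrier S. act (g x) s \<in> B} \<and> (\<forall>e\<in>E x. e \<otimes> e = e) \<and>
      (\<forall>u. u \<in> carrier S \<and> act (g x) u \<in> B \<longrightarrow> (\<exists>e\<in>E x. u = e \<otimes> u))" ..
  then have E: "\<And>x. x \<in> X \<Longrightarrow> finite (E x)"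
    "\<And>x e. x \<in> X \<Longrightarrow> e \<in> E x \<Longrightarrow> e \<in> carrier S \<and> act (g x) e \<in> B \<and> e \<otimes> e = e"
    "\<And>x u. x \<in> X \<Longrightarrow> u \<in> carrier S \<Longrightarrow> act (g x) u \<in> B \<Longrightarrow> \<exists>e\<in>E x. u = e \<otimes> u"
    by (simp, blast, simp)
  define Z where "Z = Sigma X E"
  have "finite Z"
    using X E(1) by (simp add: Z_def)
  \<comment> \<open>\<open>fp_act\<close> asks for a basis of natural numbers, so the pairs in
    \<open>Z\<close> are numbered.\<close>
  then obtain h and n :: nat where h: "bij_betw h {..<n} Z"
    using ex_bij_betw_nat_finite[of Z] by (auto simp: atLeast0LessThan)
  define Y where "Y = {..<n}"
  define x where "x = (\<lambda>y. fst (h y))"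
  define e where "e = (\<lambda>y. snd (h y))"
  have hZ: "(x y, e y) \<in> Z" if "y \<in> Y" for y
    using h that by (auto simp: bij_betw_def Y_def x_def e_def)
  have xe: "x y \<in> X" "e y \<in> carrier S" "act (g (x y)) (e y) \<in> B" "e y \<otimes> e y = e y"
    if "y \<in> Y" for y
    using hZ[OF that] E(2) by (auto simp: Z_def)
  have lift: "\<exists>y\<in>Y. x y = c \<and> u = e y \<otimes> u"
    if cu: "c \<in> X" "u \<in> carrier S" "act (g c) u \<in> B" for c u
  proof -
    obtain d where "d \<in> E c" "u = d \<otimes> u"
      using E(3)[OF cu] by blast
    moreover have "(c, d) \<in> h ` Y"
      using h \<open>d \<in> E c\<close> cu(1) by (auto simp: bij_betw_def Y_def Z_def)
    ultimately show ?thesis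
      unfolding x_def e_def by (metis fst_conv imageE snd_conv)
  qed
  let ?H = "free_act_carrier S Y"
  \<comment> \<open>\<open>\<theta>\<close> is the homomorphism of free acts sending the basis
    element \<open>y\<close> to \<open>(x y, e y)\<close>. Its image is the preimage of
    \<open>B\<close>, and following it by \<open>free_act_map g act\<close> gives the map onto
    \<open>B\<close> that extends \<open>g'\<close>.\<close>
  define \<theta> where "\<theta> = (\<lambda>p. (x (fst p), e (fst p) \<otimes> snd p))"
  define g' where "g' = (\<lambda>y. act (g (x y)) (e y))"
  have g'Y: "g' ` Y \<subseteq> B"
    using xe by (auto simp: g'_def)
  have \<theta>_closed: "\<theta> p \<in> ?F" if "p \<in> ?H" for p
    using that xe by (auto simp: \<theta>_def free_act_carrier_def)
  have \<theta>_act: "\<theta> (free_act S p s) = free_act S (\<theta> p) s" if "p \<in> ?H" "s \<in> carrier S" for p s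
    using that xe by (auto simp: \<theta>_def free_act_carrier_def free_act_def m_assoc)
  have map_\<theta>: "free_act_map g act (\<theta> p) = free_act_map g' act p" if "p \<in> ?H" for p
    using that xe gX by (auto simp: \<theta>_def g'_def free_act_carrier_def free_act_map_def
        act_mult image_subset_iff)
  have \<theta>_surj: "\<exists>p\<in>?H. \<theta> p = a" if "a \<in> ?F" "free_act_map g act a \<in> B" for a
  proof -
    obtain c u where a: "a = (c, u)" "c \<in> X" "u \<in> carrier S"
      using \<open>a \<in> ?F\<close> by (auto simp: free_act_carrier_def)
    then obtain y where "y \<in> Y" "x y = c" "u = e y \<otimes> u"
      using lift[of c u] \<open>free_act_map g act a \<in> B\<close> by (auto simp: free_act_map_def)
    then show ?thesis
      using a by (intro bexI[of _ "(y, u)"]) (auto simp: \<theta>_def free_act_carrier_def)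
  qed
  have mapB: "free_act_map g act (\<theta> p) \<in> B" if "p \<in> ?H" for p
    using map_\<theta>[OF that] that g'Y B_closed
    by (auto simp: free_act_map_def free_act_carrier_def image_subset_iff)
  have surj': "free_act_map g' act ` ?H = B"
  proof
    show "free_act_map g' act ` ?H \<subseteq> B"
      using map_\<theta> mapB by force
    show "B \<subseteq> free_act_map g' act ` ?H"
    proof
      fix b assume b: "b \<in> B"
      then obtain a where a: "a \<in> ?F" "b = free_act_map g act a"
        using surj BA by blast
      then obtain p where "p \<in> ?H" "\<theta> p = a"
        using \<theta>_surj b by blast
      then show "b \<in> free_act_map g' act ` ?H"
        using map_\<theta>[of p] a by blast
    qed
  qed

  \<comment> \<open>When \<open>x y = x z\<close>, these are the second coordinates that
    \<open>\<theta>\<close> reaches from both \<open>y\<close> and \<open>z\<close>.\<close>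
  define W where "W = (\<lambda>y z. ((\<lambda>s. e y \<otimes> s) ` carrier S) \<inter> ((\<lambda>s. e z \<otimes> s) ` carrier S))"
  have "\<forall>y\<in>Y. \<forall>z\<in>Y. \<exists>F. finite F \<and> F \<subseteq> W y z \<and>
      (\<forall>u\<in>W y z. \<exists>a\<in>F. \<exists>s\<in>carrier S. u = a \<otimes> s)"
  proof (intro ballI)
    fix y z assume "y \<in> Y" "z \<in> Y"
    then have "right_ideal S (W y z)"
      unfolding W_def using xe by (intro right_ideal_inter right_ideal_principal) auto
    from weakly_right_noetherianE[OF noeth this]
    show "\<exists>F. finite F \<and> F \<subseteq> W y z \<and> (\<forall>u\<in>W y z. \<exists>a\<in>F. \<exists>s\<in>carrier S. u = a \<otimes> s)"
      by metis
  qed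
  then obtain GW where GW: "\<And>y z. y \<in> Y \<Longrightarrow> z \<in> Y \<Longrightarrow> finite (GW y z)"
    "\<And>y z. y \<in> Y \<Longrightarrow> z \<in> Y \<Longrightarrow> GW y z \<subseteq> W y z"
    "\<And>y z u. y \<in> Y \<Longrightarrow> z \<in> Y \<Longrightarrow> u \<in> W y z \<Longrightarrow> \<exists>a\<in>GW y z. \<exists>s\<in>carrier S. u = a \<otimes> s"
    by metis

  \<comment> \<open>These \<open>v\<close> translate \<open>p\<close> and \<open>q\<close>, as far
    as second coordinates go, into the images under \<open>\<theta>\<close> of the summands
    \<open>y\<close> and \<open>z\<close>. Agreement of the first coordinates is imposed in
    \<open>T3\<close>.\<close>
  define V where "V = (\<lambda>(p :: nat \<times> 'a, q :: nat \<times> 'a) (y, z). {v \<in> carrier S. snd p \<otimes> v \<in> (\<lambda>s. e y \<otimes> s) ` carrier S} \<inter>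
    {v \<in> carrier S. snd q \<otimes> v \<in> (\<lambda>s. e z \<otimes> s) ` carrier S})"
  have "\<forall>r\<in>R. \<forall>k\<in>Y \<times> Y. \<exists>F. finite F \<and> F \<subseteq> V r k \<and>
      (\<forall>u\<in>V r k. \<exists>a\<in>F. \<exists>s\<in>carrier S. u = a \<otimes> s)"
  proof (intro ballI)
    fix r k assume "r \<in> R" "k \<in> Y \<times> Y"
    then have "right_ideal S (V r k)"
      using xe R(2)
      by (auto simp: V_def free_act_kernel_def free_act_carrier_def
          intro!: right_ideal_inter right_ideal_colon right_ideal_principal)
    from weakly_right_noetherianE[OF noeth this]
    show "\<exists>F. finite F \<and> F \<subseteq> V r k \<and> (\<forall>u\<in>V r k. \<exists>a\<in>F. \<exists>s\<in>carrier S. u = a \<otimes> s)"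
      by metis
  qed
  from this[unfolded bchoice_iff] obtain GV where GV0: "\<forall>r\<in>R. \<forall>k\<in>Y \<times> Y.
      finite (GV r k) \<and> GV r k \<subseteq> V r k \<and> (\<forall>u\<in>V r k. \<exists>a\<in>GV r k. \<exists>s\<in>carrier S. u = a \<otimes> s)" ..
  then have GV: "\<And>r k. r \<in> R \<Longrightarrow> k \<in> Y \<times> Y \<Longrightarrow> finite (GV r k)"
    "\<And>r k. r \<in> R \<Longrightarrow> k \<in> Y \<times> Y \<Longrightarrow> GV r k \<subseteq> V r k"
    "\<And>r k u. r \<in> R \<Longrightarrow> k \<in> Y \<times> Y \<Longrightarrow> u \<in> V r k \<Longrightarrow> \<exists>a\<in>GV r k. \<exists>s\<in>carrier S. u = a \<otimes> s"
    by blast+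

  define T1 where "T1 = (\<lambda>y. ((y, e y), (y, \<one>))) ` Y"
  define T2 where "T2 = (\<Union>(y, z)\<in>{(y, z). y \<in> Y \<and> z \<in> Y \<and> x y = x z}.
    (\<lambda>w. ((y, w), (z, w))) ` GW y z)"
  define T3 where "T3 = (\<Union>r\<in>R. \<Union>(y, z)\<in>{(y, z). y \<in> Y \<and> z \<in> Y \<and>
      fst (fst r) = x y \<and> fst (snd r) = x z}.
    (\<lambda>v. ((y, snd (fst r) \<otimes> v), (z, snd (snd r) \<otimes> v))) ` GV r (y, z))"
  let ?\<kappa> = "free_act_kernel S Y g' act"
  have fin: "finite (T1 \<union> T2 \<union> T3)"
  proof -
    have "finite Y"
      by (simp add: Y_def)
    then have pairs: "finite {(y, z). y \<in> Y \<and> z \<in> Y \<and> P y z}" for P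
      by (rule_tac finite_subset[of _ "Y \<times> Y"]) auto
    have "finite T1"
      using \<open>finite Y\<close> by (simp add: T1_def)
    moreover have "finite T2"
      unfolding T2_def using GW(1) by (intro finite_UN_I[OF pairs]) auto
    moreover have "finite T3"
      unfolding T3_def using GV(1) by (intro finite_UN_I[OF R(1)] finite_UN_I[OF pairs]) auto
    ultimately show ?thesis
      by simp
  qed
  \<comment> \<open>By \<open>map_\<theta>\<close>, the kernel for \<open>B\<close> is the inverse
    image of \<open>?\<rho>\<close> under \<open>\<theta>\<close>, so relations can be checked in
    \<open>?F\<close>.\<close>
  have kerI: "(p, q) \<in> ?\<kappa>" if "p \<in> ?H" "q \<in> ?H" "(\<theta> p, \<theta> q) \<in> ?\<rho>" for p q
    using that map_\<theta> by (auto simp: free_act_kernel_def)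
  have \<rho>_refl: "(a, a) \<in> ?\<rho>" if "a \<in> ?F" for a
    using that by (simp add: free_act_kernel_def)
  \<comment> \<open>Idempotence makes \<open>e y\<close> a left identity on the ideal it generates,
    so \<open>\<theta>\<close> leaves such a second coordinate unchanged.\<close>
  have absorb: "e y \<otimes> u = u" if "y \<in> Y" "u \<in> (\<lambda>s. e y \<otimes> s) ` carrier S" for y u
    using that xe by (auto simp: m_assoc[symmetric])

  \<comment> \<open>The relations hold in \<open>B\<close>\<close>
  have incl: "T1 \<union> T2 \<union> T3 \<subseteq> ?\<kappa>"
  proof -
    have "T1 \<subseteq> ?\<kappa>"
      using xe by (auto simp: T1_def free_act_carrier_def \<theta>_def intro!: kerI \<rho>_refl)
    moreover have "T2 \<subseteq> ?\<kappa>"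
    proof -
      have "((y, w), (z, w)) \<in> ?\<kappa>" if "y \<in> Y" "z \<in> Y" "x y = x z" "w \<in> GW y z" for y z w
      proof (rule kerI)
        have w: "w \<in> W y z"
          using GW(2) that by blast
        then have "w \<in> carrier S"
          using xe that by (auto simp: W_def)
        then show yH: "(y, w) \<in> ?H" and "(z, w) \<in> ?H"
          using that by (auto simp: free_act_carrier_def)
        have "e y \<otimes> w = w" "e z \<otimes> w = w"
          using w that absorb unfolding W_def by blast+
        then have "\<theta> (y, w) = \<theta> (z, w)"
          using that by (simp add: \<theta>_def)
        then show "(\<theta> (y, w), \<theta> (z, w)) \<in> ?\<rho>"
          using \<rho>_refl \<theta>_closed yH by metis
      qed
      then show ?thesis
        by (auto simp: T2_def)
    qed
    moreover have "T3 \<subseteq> ?\<kappa>"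
    proof -
      have "((y, snd p \<otimes> v), (z, snd q \<otimes> v)) \<in> ?\<kappa>"
        if r: "(p, q) \<in> R" and yz: "y \<in> Y" "z \<in> Y" "fst p = x y" "fst q = x z"
          and v: "v \<in> GV (p, q) (y, z)" for p q y z v
      proof (rule kerI)
        have vV: "v \<in> V (p, q) (y, z)"
          by (rule subsetD[OF GV(2)[OF r] v]) (simp add: yz)
        then have vS: "v \<in> carrier S"
          and pv: "snd p \<otimes> v \<in> (\<lambda>s. e y \<otimes> s) ` carrier S"
          and qv: "snd q \<otimes> v \<in> (\<lambda>s. e z \<otimes> s) ` carrier S"
          by (simp_all add: V_def)
        have pq: "(p, q) \<in> ?\<rho>" "snd p \<in> carrier S" "snd q \<in> carrier S"
          using r R(2) by (auto simp: free_act_kernel_def free_act_carrier_def)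
        then show "(y, snd p \<otimes> v) \<in> ?H" "(z, snd q \<otimes> v) \<in> ?H"
          using yz vS by (auto simp: free_act_carrier_def)
        have "\<theta> (y, snd p \<otimes> v) = free_act S p v" "\<theta> (z, snd q \<otimes> v) = free_act S q v"
          using absorb[OF yz(1) pv] absorb[OF yz(2) qv] yz(3,4)
          by (simp_all add: \<theta>_def free_act_def)
        then show "(\<theta> (y, snd p \<otimes> v), \<theta> (z, snd q \<otimes> v)) \<in> ?\<rho>"
          using act_congruenceD(4)[OF act_congruence_free_act_kernel[OF gX] pq(1) vS] by simp
      qed
      then show ?thesis
        unfolding T3_def by clarsimp
    qed
    ultimately show ?thesis
      by blast
  qed

  \<comment> \<open>The relations generate the kernel\<close>
  have least: "?\<kappa> \<subseteq> \<sigma>"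
    if \<sigma>: "act_congruence S ?H (free_act S) \<sigma>" and T: "T1 \<union> T2 \<union> T3 \<subseteq> \<sigma>" for \<sigma>
  proof -
    note \<sigma>D = act_congruenceD[OF \<sigma>]
    have norm: "((y, e y \<otimes> s), (y, s)) \<in> \<sigma>" if "y \<in> Y" "s \<in> carrier S" for y s
    proof -
      have "((y, e y), (y, \<one>)) \<in> \<sigma>"
        using T that by (auto simp: T1_def)
      from \<sigma>D(4)[OF this that(2)] show ?thesis
        using that by (simp add: free_act_def)
    qed
    \<comment> \<open>The kernel of \<open>\<theta>\<close> lies in \<open>\<sigma>\<close>:
      \<open>norm\<close> moves both elements to their common second coordinate, which lies in
      \<open>W y z\<close>, and a translate of a \<open>T2\<close> relation switches from
      \<open>y\<close> to \<open>z\<close>.\<close>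
    have collapse: "(a, b) \<in> \<sigma>" if ab: "a \<in> ?H" "b \<in> ?H" "\<theta> a = \<theta> b" for a b
    proof -
      obtain y s z t where [simp]: "a = (y, s)" "b = (z, t)"
        by fastforce
      have m: "y \<in> Y" "z \<in> Y" "s \<in> carrier S" "t \<in> carrier S"
        using ab by (auto simp: free_act_carrier_def)
      have xx: "x y = x z" and ee: "e y \<otimes> s = e z \<otimes> t"
        using ab(3) by (auto simp: \<theta>_def)
      have "e y \<otimes> s \<in> W y z"
        unfolding W_def using m ee by (metis IntI imageI)
      then obtain w r where w: "w \<in> GW y z" "r \<in> carrier S" "e y \<otimes> s = w \<otimes> r"
        using GW(3) m by blast
      have "((y, w), (z, w)) \<in> \<sigma>"
        using T m xx w(1) unfolding T2_def by blast
      from \<sigma>D(4)[OF this w(2)] have "((y, e y \<otimes> s), (z, e z \<otimes> t)) \<in> \<sigma>"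
        using w(3) ee by (simp add: free_act_def)
      from \<sigma>D(3)[OF \<sigma>D(3)[OF \<sigma>D(2)[OF norm[OF m(1,3)]] this] norm[OF m(2,4)]]
      show ?thesis
        by simp
    qed
    text \<open>The clause ranges over all translates by \<open>v\<close>, since those may lie in the preimage of
      \<open>B\<close> even when \<open>a\<close> and \<open>b\<close> do not.\<close>
    define \<tau> where "\<tau> = {(a, b) \<in> ?\<rho>. \<forall>v\<in>carrier S. \<forall>p\<in>?H. \<forall>q\<in>?H.
      \<theta> p = free_act S a v \<and> \<theta> q = free_act S b v \<longrightarrow> (p, q) \<in> \<sigma>}"
    note \<rho>D = act_congruenceD[OF act_congruence_free_act_kernel[OF gX]]
    have \<tau>D: "(a, b) \<in> ?\<rho>"
      "\<And>v p q. v \<in> carrier S \<Longrightarrow> p \<in> ?H \<Longrightarrow> q \<in> ?H \<Longrightarrow> \<theta> p = free_act S a v \<Longrightarrow>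
        \<theta> q = free_act S b v \<Longrightarrow> (p, q) \<in> \<sigma>" if "(a, b) \<in> \<tau>" for a b
      using that by (simp_all add: \<tau>_def)
    have \<tau>I: "(a, b) \<in> \<tau>" if "(a, b) \<in> ?\<rho>"
      "\<And>v p q. v \<in> carrier S \<Longrightarrow> p \<in> ?H \<Longrightarrow> q \<in> ?H \<Longrightarrow> \<theta> p = free_act S a v \<Longrightarrow>
        \<theta> q = free_act S b v \<Longrightarrow> (p, q) \<in> \<sigma>" for a b
      using that by (simp add: \<tau>_def)
    \<comment> \<open>Minimality of \<open>?\<rho>\<close> replaces induction along chains of
      \<open>R\<close>-steps: it suffices that \<open>\<tau>\<close> is a congruence containing
      \<open>R\<close>.\<close>
    have "act_congruence S ?F (free_act S) \<tau>"
    proof (rule act_congruenceI)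
      show "\<tau> \<subseteq> ?F \<times> ?F"
        using \<tau>D(1) \<rho>D(5) by (meson mem_Sigma_iff subrelI)
      show "(a, a) \<in> \<tau>" if "a \<in> ?F" for a
        by (rule \<tau>I[OF \<rho>_refl[OF that]]) (simp add: collapse)
      show "(b, a) \<in> \<tau>" if "(a, b) \<in> \<tau>" for a b
        by (rule \<tau>I[OF \<rho>D(2)[OF \<tau>D(1)[OF that]]], rule \<sigma>D(2), rule \<tau>D(2)[OF that])
      show "(a, c) \<in> \<tau>" if ab: "(a, b) \<in> \<tau>" and bc: "(b, c) \<in> \<tau>" for a b c
      proof -
        have "(p, q) \<in> \<sigma>" if v: "v \<in> carrier S" and pq: "p \<in> ?H" "q \<in> ?H"
          "\<theta> p = free_act S a v" "\<theta> q = free_act S c v" for v p q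
        proof -
          \<comment> \<open>The translate of the middle element \<open>b\<close> is
            \<open>?\<rho>\<close>-related to \<open>\<theta> p\<close>, which lies over
            \<open>B\<close>; so it too has a lift \<open>r\<close>, which joins \<open>p\<close> to
            \<open>q\<close> modulo \<open>\<sigma>\<close>.\<close>
          have "(free_act S a v, free_act S b v) \<in> ?\<rho>"
            by (rule \<rho>D(4)[OF \<tau>D(1)[OF ab] v])
          then have "free_act S b v \<in> ?F" "free_act_map g act (free_act S b v) \<in> B"
            using mapB[OF pq(1)] pq(3) by (auto simp: free_act_kernel_def)
          then obtain r where "r \<in> ?H" "\<theta> r = free_act S b v"
            using \<theta>_surj by blast
          then show ?thesis
            using \<sigma>D(3) \<tau>D(2)[OF ab v] \<tau>D(2)[OF bc v] pq by metis
        qed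
        then show ?thesis
          by (rule \<tau>I[OF \<rho>D(3)[OF \<tau>D(1)[OF ab] \<tau>D(1)[OF bc]]])
      qed
      show "(free_act S a s, free_act S b s) \<in> \<tau>" if ab: "(a, b) \<in> \<tau>" and s: "s \<in> carrier S" for a b s
      proof -
        have F: "a \<in> ?F" "b \<in> ?F"
          using \<rho>D(5)[OF \<tau>D(1)[OF ab]] by simp_all
        \<comment> \<open>A translate of \<open>a s\<close> is again a translate of
          \<open>a\<close>, so the quantifier over \<open>v\<close> in \<open>\<tau>\<close> yields
          stability under the action.\<close>
        have "free_act S (free_act S c s) v = free_act S c (s \<otimes> v)"
          if "c \<in> ?F" "v \<in> carrier S" for c v
          using that s by (auto simp: free_act_def free_act_carrier_def m_assoc)
        then show ?thesis
          using F s by (intro \<tau>I[OF \<rho>D(4)[OF \<tau>D(1)[OF ab] s]] \<tau>D(2)[OF ab]) auto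
      qed
    qed
    moreover have "R \<subseteq> \<tau>"
    proof -
      have "((y, s), (z, t)) \<in> \<sigma>"
        if r: "(p, q) \<in> R" and v: "v \<in> carrier S" and m: "y \<in> Y" "z \<in> Y" "s \<in> carrier S" "t \<in> carrier S"
          and eqs: "\<theta> (y, s) = free_act S p v" "\<theta> (z, t) = free_act S q v" for p q v y s z t
      proof -
        have pS: "snd p \<in> carrier S" "snd q \<in> carrier S"
          using r R(2) by (auto simp: free_act_kernel_def free_act_carrier_def)
        have xs: "fst p = x y" "fst q = x z"
          and es: "snd p \<otimes> v = e y \<otimes> s" "snd q \<otimes> v = e z \<otimes> t"
          using eqs by (auto simp: \<theta>_def free_act_def)
        \<comment> \<open>Hence \<open>v = k \<otimes> w\<close> for a chosen generator
          \<open>k\<close>. The \<open>T3\<close> relation for \<open>k\<close>, translated by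
          \<open>w\<close>, links the two elements up to \<open>norm\<close>.\<close>
        have "v \<in> V (p, q) (y, z)"
          using v m es by (auto simp: V_def)
        then obtain k w where k: "k \<in> GV (p, q) (y, z)" "w \<in> carrier S" "v = k \<otimes> w"
          using GV(3)[OF r, of "(y, z)" v] m by blast
        have kS: "k \<in> carrier S"
          using GV(2)[OF r, of "(y, z)"] k(1) m by (auto simp: V_def)
        have "((y, snd p \<otimes> k), (z, snd q \<otimes> k)) \<in> T3"
          unfolding T3_def using r m xs k(1) by force
        then have "((y, snd p \<otimes> k), (z, snd q \<otimes> k)) \<in> \<sigma>"
          using T by blast
        from \<sigma>D(4)[OF this k(2)] have "((y, e y \<otimes> s), (z, e z \<otimes> t)) \<in> \<sigma>"
          using k(2,3) kS pS es by (simp add: free_act_def m_assoc)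
        from \<sigma>D(3)[OF \<sigma>D(3)[OF \<sigma>D(2)[OF norm[OF m(1,3)]] this] norm[OF m(2,4)]]
        show ?thesis .
      qed
      then show ?thesis
        using R(2) by (auto simp: free_act_carrier_def intro!: \<tau>I)
    qed
    ultimately have sub: "?\<rho> \<subseteq> \<tau>"
      by (rule min)
    show "?\<kappa> \<subseteq> \<sigma>"
    proof clarify
      fix y s z t assume k: "((y, s), (z, t)) \<in> ?\<kappa>"
      then have H: "(y, s) \<in> ?H" "(z, t) \<in> ?H"
        by (auto simp: free_act_kernel_def)
      then have "(\<theta> (y, s), \<theta> (z, t)) \<in> ?\<rho>"
        using k map_\<theta>[OF H(1)] map_\<theta>[OF H(2)] \<theta>_closed by (simp add: free_act_kernel_def)
      then have "(\<theta> (y, s), \<theta> (z, t)) \<in> \<tau>"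
        using sub by blast
      \<comment> \<open>With \<open>v = \<one>\<close> the condition in \<open>\<tau>\<close> speaks
        of lifts of the pair itself, and \<open>(y, s)\<close>, \<open>(z, t)\<close> are such
        lifts.\<close>
      moreover have "a = free_act S a \<one>" if "a \<in> ?F" for a
        using that by (auto simp: free_act_def free_act_carrier_def)
      ultimately show "((y, s), (z, t)) \<in> \<sigma>"
        using \<tau>D(2)[OF _ one_closed H] H \<theta>_closed by blast
    qed
  qed
  have "fg_congruence S ?H (free_act S) ?\<kappa>"
    unfolding fg_congruence_def
  proof (intro conjI exI allI impI)
    show "act_congruence S ?H (free_act S) ?\<kappa>"
      by (rule B.act_congruence_free_act_kernel[OF g'Y])
    show "finite (T1 \<union> T2 \<union> T3)" "T1 \<union> T2 \<union> T3 \<subseteq> ?\<kappa>"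
      by (rule fin incl)+
    show "?\<kappa> \<subseteq> \<sigma>" if "act_congruence S ?H (free_act S) \<sigma> \<and> T1 \<union> T2 \<union> T3 \<subseteq> \<sigma>" for \<sigma>
      using that by (intro least) simp_all
  qed
  moreover have "finite Y"
    by (simp add: Y_def)
  ultimately show ?thesis
    unfolding B.fp_act_iff using g'Y surj' by blast
qed

end

theorem corollary3p3:
  fixes S :: "('a, 'm) monoid_scheme"
  assumes "monoid S"
    and "weakly_right_noetherian S"
    and "regular_monoid S"
  shows "right_coherent TYPE('b) S"
  unfolding right_coherent_def
  using right_act.fp_act_subact[OF _ assms(2,3)] by blast

end
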